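(* Let $d\in\mathbb N$. For $N\in\mathbb N$, functions $f_1,\dots,f_{d+1}:\mathbb Z\to\mathbb C$ and $n\in\mathbb Z$, set $$A_N(f_1,\dots,f_{d+1})(n)=\frac1{N^d}\sum_{m_1=1}^{N}\cdots\sum_{m_d=1}^{N}f_1(n-m_1)\cdots f_d(n-m_d)\,f_{d+1}\big(n-(m_1^2+\cdots+m_d^2)\big)$$ and $T^*(f_1,\dots,f_{d+1})(n)=\sup_{N\in\mathbb N}|A_N(f_1,\dots,f_{d+1})(n)|$. Then there is a constant $C$, independent of the $f_j$'s, such that for all $f_1,\dots,f_{d+1}\in L^2(\mathbb Z)$, $$\left\|T^*(f_1,\dots,f_{d+1})\right\|_{L^2(\mathbb Z)}\le C\prod_{j=1}^{d+1}\|f_j\|_{L^2(\mathbb Z)} .$$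
   Context: $L^2(\mathbb Z)$ is taken with respect to counting measure; $\mathbb N=\{1,2,\dots\}$. *)

theory Defs
  imports "HOL-Analysis.Analysis"
begin

definition in_L2 :: "(int \<Rightarrow> 'a::{banach, second_countable_topology}) \<Rightarrow> bool" where
  "in_L2 f \<longleftrightarrow> integrable (count_space UNIV) (\<lambda>n. (norm (f n))\<^sup>2)"

definition L2_norm :: "(int \<Rightarrow> 'a::{banach, second_countable_topology}) \<Rightarrow> real" where
  "L2_norm f = sqrt (LINT n|count_space UNIV. (norm (f n))\<^sup>2)"

text \<open>The functions \<open>f\<^sub>1, \<dots>, f\<^sub>d\<^sub>+\<^sub>1\<close> are \<open>f 1, \<dots>, f (d + 1)\<close>, and the \<open>d\<close>-fold sum
  runs over all tuples \<open>m = (m 1, \<dots>, m d)\<close> with entries in \<open>{1..N}\<close>.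
  Only \<open>N \<ge> 1\<close> is meaningful.\<close>

definition avg :: "nat \<Rightarrow> nat \<Rightarrow> (nat \<Rightarrow> int \<Rightarrow> complex) \<Rightarrow> int \<Rightarrow> complex" where
  "avg d N f n =
     1 / of_nat N ^ d *
       (\<Sum>m \<in> {1..d} \<rightarrow>\<^sub>E {1..N}.
          (\<Prod>i = 1..d. f i (n - int (m i))) * f (d + 1) (n - (\<Sum>i = 1..d. (int (m i))\<^sup>2)))"

text \<open>A supremum of reals: it is the true supremum only where the averages are bounded in \<open>N\<close>,
  so boundedness has to be asserted alongside any estimate of it.\<close>

definition maximal_fun :: "nat \<Rightarrow> (nat \<Rightarrow> int \<Rightarrow> complex) \<Rightarrow> int \<Rightarrow> real" where
  "maximal_fun d f n = (SUP N \<in> {1..}. cmod (avg d N f n))"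

end

theory Submission imports Defs begin

text \<open>Bound the factors \<open>f 2, \<dots>, f d\<close> pointwise by their \<open>L\<^sup>2\<close> norms and, for fixed
  \<open>m 2, \<dots>, m d\<close>, apply Cauchy--Schwarz to the sum over \<open>m 1\<close>. Since squares are distinct, the factor
  involving \<open>f (d + 1)\<close> contributes at most its norm, and what remains of the average is the square
  root of \<open>N\<^sup>-\<^sup>2 (\<Sum>m\<le>N. \<bar>f 1 (n - m)\<bar>\<^sup>2)\<close>. As \<open>N\<^sup>-\<^sup>2 \<le> m\<^sup>-\<^sup>2\<close>, the radicand is at most
  \<open>\<Sum>m. m\<^sup>-\<^sup>2 \<bar>f 1 (n - m)\<bar>\<^sup>2\<close>, which no longer depends on \<open>N\<close> and is summable in \<open>n\<close>.\<close>

lemma L2_norm_nonneg [simp]: "0 \<le> L2_norm f"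
  by (simp add: L2_norm_def)

lemma sum_le_L2_norm:
  assumes "in_L2 f" "finite A"
  shows "(\<Sum>n\<in>A. (norm (f n))\<^sup>2) \<le> (L2_norm f)\<^sup>2"
proof -
  \<comment> \<open>The integral over counting measure is by definition an \<open>infsetsum\<close>,
    which for nonnegative terms grows with the index set.\<close>
  have abs: "Infinite_Set_Sum.abs_summable_on (\<lambda>n. (norm (f n))\<^sup>2) UNIV"
    using assms(1) by (simp add: in_L2_def abs_summable_on_def)
  have "(\<Sum>n\<in>A. (norm (f n))\<^sup>2) = infsetsum (\<lambda>n. (norm (f n))\<^sup>2) A"
    using assms(2) by simp
  also have "\<dots> \<le> infsetsum (\<lambda>n. (norm (f n))\<^sup>2) UNIV"
    using abs assms(2) by (intro infsetsum_mono_neutral_left) auto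
  also have "\<dots> = (L2_norm f)\<^sup>2"
    by (simp add: L2_norm_def infsetsum_def)
  finally show ?thesis .
qed

text \<open>Injectivity of \<open>h\<close> keeps any value of \<open>f\<close> from being counted
  twice. It serves for translations and for the points \<open>c - y\<^sup>2\<close>.\<close>

lemma sum_comp_le_L2_norm:
  assumes "in_L2 f" "finite A" "inj_on h A"
  shows "(\<Sum>x\<in>A. (norm (f (h x)))\<^sup>2) \<le> (L2_norm f)\<^sup>2"
  using sum_le_L2_norm[OF assms(1), of "h ` A"] assms(2,3)
  by (simp add: sum.reindex)

lemma norm_le_L2_norm: "in_L2 f \<Longrightarrow> norm (f n) \<le> L2_norm f"
  using sum_le_L2_norm[of f "{n}"] by (auto intro: power2_le_imp_le)

text \<open>Converse of \<open>sum_le_L2_norm\<close>: finite sums alone give both membership and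
  the norm bound for the maximal function.\<close>

lemma L2_bound_finite_sums:
  assumes "\<And>A. finite A \<Longrightarrow> (\<Sum>n\<in>A. (norm (f n))\<^sup>2) \<le> B\<^sup>2" "0 \<le> B"
  shows "in_L2 f" "L2_norm f \<le> B"
proof -
  \<comment> \<open>\<open>summable_on\<close> has the criterion by bounded finite sums; its value
    is then carried over to the integral through \<open>infsetsum\<close>.\<close>
  have s: "(\<lambda>n. (norm (f n))\<^sup>2) summable_on UNIV"
    using assms(1) by (intro nonneg_bdd_above_summable_on) (auto intro!: bdd_aboveI)
  hence abs: "Infinite_Set_Sum.abs_summable_on (\<lambda>n. (norm (f n))\<^sup>2) UNIV"
    by (simp flip: abs_summable_equivalent)
  thus "in_L2 f"
    by (simp add: in_L2_def abs_summable_on_def)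
  have "(LINT n|count_space UNIV. (norm (f n))\<^sup>2) = infsum (\<lambda>n. (norm (f n))\<^sup>2) UNIV"
    using infsetsum_infsum[OF abs] by (simp add: infsetsum_def)
  also have "\<dots> \<le> B\<^sup>2"
    using s assms(1) by (intro infsum_le_finite_sums) auto
  finally show "L2_norm f \<le> B"
    unfolding L2_norm_def using assms(2) by (simp add: real_le_lsqrt)
qed

text \<open>Splits off one coordinate and puts its sum innermost, where Cauchy-Schwarz is applied
  with the other coordinates fixed.\<close>

lemma sum_PiE_insert:
  assumes "x \<notin> S"
  shows "(\<Sum>m\<in>Pi\<^sub>E (insert x S) T. h m) = (\<Sum>g\<in>Pi\<^sub>E S T. \<Sum>y\<in>T x. h (g(x := y)))"
proof -
  have "(\<Sum>m\<in>Pi\<^sub>E (insert x S) T. h m) = (\<Sum>(y, g)\<in>T x \<times> Pi\<^sub>E S T. h (g(x := y)))"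
    unfolding PiE_insert_eq using inj_combinator[OF assms, of T]
    by (subst sum.reindex) (auto simp: case_prod_unfold)
  also have "\<dots> = (\<Sum>y\<in>T x. \<Sum>g\<in>Pi\<^sub>E S T. h (g(x := y)))"
    by (simp add: sum.cartesian_product)
  finally show ?thesis
    by (simp add: sum.swap[of _ "T x"])
qed

text \<open>Squaring is injective on naturals; over the integers \<open>y\<close> and
  \<open>-y\<close> would collide.\<close>

lemma inj_on_diff_int_square: "inj_on (\<lambda>y::nat. c - (int y)\<^sup>2) A"
  by (auto simp: inj_on_def)

lemma norm_avg_le:
  assumes "d \<ge> 1" "N \<ge> 1" and L2: "\<forall>j\<in>{1..d + 1}. in_L2 (f j)"
  shows "cmod (avg d N f n) \<le>
    (\<Prod>j=2..d + 1. L2_norm (f j)) * (L2_set (\<lambda>y. norm (f 1 (n - int y))) {1..N} / N)"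
proof -
  let ?K = "\<Prod>j=2..d. L2_norm (f j)" and ?F = "L2_set (\<lambda>y. norm (f 1 (n - int y))) {1..N}"
  let ?t = "\<lambda>m. (\<Prod>i=1..d. f i (n - int (m i))) * f (d + 1) (n - (\<Sum>i=1..d. (int (m i))\<^sup>2))"
  \<comment> \<open>For \<open>d = 1\<close> the set \<open>{2..d}\<close> is empty and
    \<open>?K = 1\<close>, so this case needs no separate treatment.\<close>
  have ins: "{1..d} = insert 1 {2..d}"
    using assms(1) by auto
  have inner: "(\<Sum>y=1..N. cmod (?t (g(1 := y)))) \<le> ?K * (?F * L2_norm (f (d + 1)))" for g
  proof -
    \<comment> \<open>\<open>c\<close> absorbs the squares of the fixed coordinates, so the last
      factor depends on \<open>y\<close> only through \<open>c - y\<^sup>2\<close>.\<close>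
    define c where "c = n - (\<Sum>i=2..d. (int (g i))\<^sup>2)"
    have "cmod (?t (g(1 := y))) \<le>
        ?K * (\<bar>cmod (f 1 (n - int y))\<bar> * \<bar>cmod (f (d + 1) (c - (int y)\<^sup>2))\<bar>)" for y
    proof -
      have p: "(\<Prod>i=1..d. f i (n - int ((g(1 := y)) i))) =
          f 1 (n - int y) * (\<Prod>i=2..d. f i (n - int (g i)))"
        unfolding ins by simp
      have s: "n - (\<Sum>i=1..d. (int ((g(1 := y)) i))\<^sup>2) = c - (int y)\<^sup>2"
        unfolding ins c_def by simp
      have "cmod (\<Prod>i=2..d. f i (n - int (g i))) \<le> ?K"
        unfolding prod_norm[symmetric] using L2 by (intro prod_mono) (auto intro!: norm_le_L2_norm)
      from mult_right_mono[OF this, of "cmod (f 1 (n - int y)) * cmod (f (d + 1) (c - (int y)\<^sup>2))"]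
      show ?thesis
        unfolding p s by (simp add: norm_mult mult_ac)
    qed
    hence "(\<Sum>y=1..N. cmod (?t (g(1 := y)))) \<le>
        ?K * (\<Sum>y=1..N. \<bar>cmod (f 1 (n - int y))\<bar> * \<bar>cmod (f (d + 1) (c - (int y)\<^sup>2))\<bar>)"
      unfolding sum_distrib_left by (rule sum_mono)
    \<comment> \<open>Cauchy-Schwarz in \<open>y\<close>.\<close>
    also have "\<dots> \<le> ?K * (?F * L2_set (\<lambda>y. cmod (f (d + 1) (c - (int y)\<^sup>2))) {1..N})"
      by (intro mult_left_mono L2_set_mult_ineq prod_nonneg) auto
    also have "\<dots> \<le> ?K * (?F * L2_norm (f (d + 1)))"
    proof (intro mult_left_mono prod_nonneg)
      show "L2_set (\<lambda>y. cmod (f (d + 1) (c - (int y)\<^sup>2))) {1..N} \<le> L2_norm (f (d + 1))"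
        unfolding L2_set_def using L2
        by (intro real_le_lsqrt sum_comp_le_L2_norm inj_on_diff_int_square) auto
    qed (auto simp: L2_set_nonneg)
    finally show ?thesis .
  qed
  have "(\<Sum>m\<in>{1..d} \<rightarrow>\<^sub>E {1..N}. cmod (?t m)) =
      (\<Sum>g\<in>{2..d} \<rightarrow>\<^sub>E {1..N}. \<Sum>y=1..N. cmod (?t (g(1 := y))))"
    using sum_PiE_insert[of 1 "{2..d}" "\<lambda>m. cmod (?t m)" "\<lambda>_. {1..N}"]
    by (simp only: ins[symmetric]) simp
  also have "\<dots> \<le> (\<Sum>g\<in>{2..d} \<rightarrow>\<^sub>E {1..N}. ?K * (?F * L2_norm (f (d + 1))))"
    by (intro sum_mono inner)
  \<comment> \<open>The bound is the same for all \<open>N ^ (d - 1)\<close> tuples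
    \<open>g\<close>; against the normalisation \<open>N ^ d\<close> a single factor
    \<open>1 / N\<close> survives.\<close>
  also have "\<dots> = real N ^ (d - 1) * (?K * (?F * L2_norm (f (d + 1))))"
    by (simp add: card_PiE)
  finally have sum: "cmod (\<Sum>m\<in>{1..d} \<rightarrow>\<^sub>E {1..N}. ?t m) \<le>
      real N ^ (d - 1) * (?K * (?F * L2_norm (f (d + 1))))"
    by (rule order_trans[OF norm_sum])
  have "cmod (avg d N f n) = 1 / real N ^ d * cmod (\<Sum>m\<in>{1..d} \<rightarrow>\<^sub>E {1..N}. ?t m)"
    by (simp add: avg_def norm_mult norm_divide norm_power)
  also have "\<dots> \<le> 1 / real N ^ d * (real N ^ (d - 1) * (?K * (?F * L2_norm (f (d + 1)))))"
    by (intro mult_left_mono sum) simp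
  also have "\<dots> = (?K * L2_norm (f (d + 1))) * (?F / N)"
    using assms(1,2) by (cases d) (auto simp: field_simps)
  also have "?K * L2_norm (f (d + 1)) = (\<Prod>j=2..d + 1. L2_norm (f j))"
    using assms(1) by simp
  finally show ?thesis .
qed

lemma summable_inverse_Suc_square: "summable (\<lambda>m. 1 / (real (Suc m))\<^sup>2)"
  using inverse_power_summable[of 2, where 'a = real]
  by (subst summable_Suc_iff) (simp add: field_simps)

text \<open>The values of \<open>f\<close> are bounded by its norm, so the weights dominate.
  \<open>Suc m\<close> appears because series start at 0 but shifts at 1.\<close>

lemma summable_weighted_square:
  assumes "in_L2 f"
  shows "summable (\<lambda>m. (norm (f (n - int (Suc m))))\<^sup>2 / (real (Suc m))\<^sup>2)"
proof (rule summable_comparison_test')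
  show "summable (\<lambda>m. (L2_norm f)\<^sup>2 * (1 / (real (Suc m))\<^sup>2))"
    by (intro summable_mult summable_inverse_Suc_square)
qed (use norm_le_L2_norm[OF assms] in \<open>auto intro!: divide_right_mono power_mono\<close>)

lemma L2_set_average_le:
  assumes "in_L2 f" "N \<ge> 1"
  shows "L2_set (\<lambda>y. norm (f (n - int y))) {1..N} / N \<le>
    sqrt (\<Sum>m. (norm (f (n - int (Suc m))))\<^sup>2 / (real (Suc m))\<^sup>2)"
proof -
  have "(\<Sum>y=1..N. (norm (f (n - int y)))\<^sup>2) / (real N)\<^sup>2 =
      (\<Sum>m<N. (norm (f (n - int (Suc m))))\<^sup>2 / (real N)\<^sup>2)"
    by (simp add: sum.atLeast1_atMost_eq sum_divide_distrib)
  also have "\<dots> \<le> (\<Sum>m<N. (norm (f (n - int (Suc m))))\<^sup>2 / (real (Suc m))\<^sup>2)"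
    by (intro sum_mono divide_left_mono power_mono mult_pos_pos) (use assms(2) in auto)
  also have "\<dots> \<le> (\<Sum>m. (norm (f (n - int (Suc m))))\<^sup>2 / (real (Suc m))\<^sup>2)"
    by (intro sum_le_suminf summable_weighted_square assms) auto
  finally have "sqrt ((\<Sum>y=1..N. (norm (f (n - int y)))\<^sup>2) / (real N)\<^sup>2) \<le>
      sqrt (\<Sum>m. (norm (f (n - int (Suc m))))\<^sup>2 / (real (Suc m))\<^sup>2)"
    by (rule real_sqrt_le_mono)
  thus ?thesis
    by (simp add: L2_set_def real_sqrt_divide)
qed

text \<open>The series is a convolution of \<open>\<bar>f\<bar>\<^sup>2\<close> with summable
  weights. Summing over \<open>n\<close> first, every translate contributes at most the squared
  norm; since \<open>A\<close> is finite, the exchange needs only summability for each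
  \<open>n\<close>.\<close>

lemma sum_weighted_square_le:
  assumes "in_L2 f" "finite A"
  shows "(\<Sum>n\<in>A. \<Sum>m. (norm (f (n - int (Suc m))))\<^sup>2 / (real (Suc m))\<^sup>2) \<le>
    (\<Sum>m. 1 / (real (Suc m))\<^sup>2) * (L2_norm f)\<^sup>2"
proof -
  have "(\<Sum>n\<in>A. \<Sum>m. (norm (f (n - int (Suc m))))\<^sup>2 / (real (Suc m))\<^sup>2) =
      (\<Sum>m. \<Sum>n\<in>A. (norm (f (n - int (Suc m))))\<^sup>2 / (real (Suc m))\<^sup>2)"
    by (intro suminf_sum[symmetric] summable_weighted_square assms)
  also have "\<dots> \<le> (\<Sum>m. 1 / (real (Suc m))\<^sup>2 * (L2_norm f)\<^sup>2)"
  proof (rule suminf_le)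
    fix m
    have "(\<Sum>n\<in>A. (norm (f (n - int (Suc m))))\<^sup>2) \<le> (L2_norm f)\<^sup>2"
      by (intro sum_comp_le_L2_norm assms) (auto simp: inj_on_def)
    thus "(\<Sum>n\<in>A. (norm (f (n - int (Suc m))))\<^sup>2 / (real (Suc m))\<^sup>2) \<le>
        1 / (real (Suc m))\<^sup>2 * (L2_norm f)\<^sup>2"
      unfolding sum_divide_distrib[symmetric] by (simp add: divide_right_mono)
  qed (intro summable_sum summable_weighted_square assms summable_mult2 summable_inverse_Suc_square)+
  also have "\<dots> = (\<Sum>m. 1 / (real (Suc m))\<^sup>2) * (L2_norm f)\<^sup>2"
    by (intro suminf_mult2[symmetric] summable_inverse_Suc_square)
  finally show ?thesis .
qed

theorem theorem5p2:
  fixes d :: nat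
  assumes "d \<ge> 1"
  shows "\<exists>C::real. \<forall>f :: nat \<Rightarrow> int \<Rightarrow> complex.
           (\<forall>j \<in> {1..d + 1}. in_L2 (f j)) \<longrightarrow>
             (\<forall>n. bdd_above ((\<lambda>N. cmod (avg d N f n)) ` {1..})) \<and>
             in_L2 (maximal_fun d f) \<and>
             L2_norm (maximal_fun d f) \<le> C * (\<Prod>j = 1..d + 1. L2_norm (f j))"
proof -
  \<comment> \<open>This is \<zeta>(2). The square root in the constant \<open>sqrt S\<close> arises
    because \<open>S\<close> bounds the squared norm.\<close>
  define S :: real where "S = (\<Sum>m. 1 / (real (Suc m))\<^sup>2)"
  have S: "0 \<le> S"
    unfolding S_def by (intro suminf_nonneg summable_inverse_Suc_square) auto
  show ?thesis
  proof (intro exI[of _ "sqrt S"] allI impI)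
    fix f :: "nat \<Rightarrow> int \<Rightarrow> complex"
    assume L2: "\<forall>j\<in>{1..d + 1}. in_L2 (f j)"
    hence f1: "in_L2 (f 1)" by simp
    define P where "P = (\<Prod>j=2..d + 1. L2_norm (f j))"
    define H where "H n = (\<Sum>m. (norm (f 1 (n - int (Suc m))))\<^sup>2 / (real (Suc m))\<^sup>2)" for n
    have P: "0 \<le> P"
      unfolding P_def by (intro prod_nonneg) auto
    have H: "0 \<le> H n" for n
      unfolding H_def by (intro suminf_nonneg summable_weighted_square f1) auto
    have avg: "cmod (avg d N f n) \<le> P * sqrt (H n)" if "N \<ge> 1" for N n
      using norm_avg_le[OF assms that L2, of n]
        mult_left_mono[OF L2_set_average_le[OF f1 that, of n] P]
      unfolding P_def H_def by linarith
    \<comment> \<open>The majorant \<open>P * sqrt (H n)\<close> is free of \<open>N\<close>, so the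
      supremum is a genuine one.\<close>
    have bdd: "bdd_above ((\<lambda>N. cmod (avg d N f n)) ` {1..})" for n
      using avg by (intro bdd_aboveI2) auto
    have max_le: "maximal_fun d f n \<le> P * sqrt (H n)" for n
      unfolding maximal_fun_def using avg by (intro cSUP_least) auto
    \<comment> \<open>Nonnegativity lets \<open>max_le\<close> be squared. It follows by comparison
      with the member \<open>N = 1\<close>, which requires boundedness.\<close>
    have max_ge: "0 \<le> maximal_fun d f n" for n
      unfolding maximal_fun_def using bdd by (intro cSUP_upper2[of _ _ 1]) auto
    have "{1..d + 1} = insert 1 {2..d + 1}" by auto
    hence prod: "(\<Prod>j=1..d + 1. L2_norm (f j)) = L2_norm (f 1) * P"
      unfolding P_def by simp
    have fin: "(\<Sum>n\<in>A. (norm (maximal_fun d f n))\<^sup>2) \<le> (sqrt S * (L2_norm (f 1) * P))\<^sup>2"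
      if "finite A" for A
    proof -
      have "(\<Sum>n\<in>A. (norm (maximal_fun d f n))\<^sup>2) \<le> (\<Sum>n\<in>A. (P * sqrt (H n))\<^sup>2)"
        using max_le max_ge by (intro sum_mono power_mono) auto
      also have "\<dots> = P\<^sup>2 * (\<Sum>n\<in>A. H n)"
        using H by (simp add: power_mult_distrib sum_distrib_left)
      also have "\<dots> \<le> P\<^sup>2 * (S * (L2_norm (f 1))\<^sup>2)"
        using sum_weighted_square_le[OF f1 that] unfolding H_def S_def by (intro mult_left_mono) auto
      also have "\<dots> = (sqrt S * (L2_norm (f 1) * P))\<^sup>2"
        using S by (simp add: power_mult_distrib)
      finally show ?thesis .
    qed
    have "0 \<le> sqrt S * (L2_norm (f 1) * P)"
      using S P by simp
    from bdd L2_bound_finite_sums[OF fin this]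
    show "(\<forall>n. bdd_above ((\<lambda>N. cmod (avg d N f n)) ` {1..})) \<and>
        in_L2 (maximal_fun d f) \<and>
        L2_norm (maximal_fun d f) \<le> sqrt S * (\<Prod>j=1..d + 1. L2_norm (f j))"
      unfolding prod by blast
  qed
qed

end
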